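(* For every integer $n\geq 1$, the circulant graph $C_{18n+3}(1,6n)$ is edge-betweenness-uniform; that is, $B'(e)$ takes the same value for all edges $e$ of $C_{18n+3}(1,6n)$.
   Context: For a positive integer $k$ and a list $L$ of positive integers, the circulant graph $C_k(L)$ is the simple undirected graph with vertices $v_1,\dots,v_k$ (indices taken modulo $k$) in which each $v_i$ is adjacent to $v_{i+j}$ and $v_{i-j}$ (indices mod $k$) for each $j\in L$. For an edge $e$ of a graph $G$, the edge betweenness centrality is $B'_G(e)=\sum_{x,y}\frac{\sigma_{xy}(e)}{\sigma_{xy}}$, written $B'(e)$ when $G$ is clear, where the sum is over all ordered pairs $(x,y)$ of distinct vertices, $\sigma_{xy}$ is the number of shortest paths between $x$ and $y$, and $\sigma_{xy}(e)$ is the number of those shortest paths that contain $e$. A graph $G$ is edge-betweenness-uniform (has uniform edge betweenness centrality) if $B'_G(e)$ has the same value for all edges $e$ of $G$. *)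

theory Defs
  imports Complex_Main "HOL-Number_Theory.Cong"
begin

record 'a sgraph =
  verts :: "'a set"
  edges :: "'a set set"

definition simple_graph :: "'a sgraph \<Rightarrow> bool" where
  "simple_graph G \<longleftrightarrow> (\<forall>e\<in>edges G. e \<subseteq> verts G \<and> card e = 2)"

definition path_between :: "'a sgraph \<Rightarrow> 'a \<Rightarrow> 'a \<Rightarrow> 'a list \<Rightarrow> bool" where
  "path_between G x y p \<longleftrightarrow>
     p \<noteq> [] \<and> hd p = x \<and> last p = y \<and> distinct p \<and> set p \<subseteq> verts G \<and>
     (\<forall>i. Suc i < length p \<longrightarrow> {p ! i, p ! Suc i} \<in> edges G)"

definition path_edges :: "'a list \<Rightarrow> 'a set set" where
  "path_edges p = {{p ! i, p ! Suc i} |i. Suc i < length p}"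

definition shortest_paths :: "'a sgraph \<Rightarrow> 'a \<Rightarrow> 'a \<Rightarrow> 'a list set" where
  "shortest_paths G x y =
     {p. path_between G x y p \<and> (\<forall>q. path_between G x y q \<longrightarrow> length p \<le> length q)}"

definition num_shortest_paths :: "'a sgraph \<Rightarrow> 'a \<Rightarrow> 'a \<Rightarrow> nat" where
  "num_shortest_paths G x y = card (shortest_paths G x y)"

definition num_shortest_paths_via :: "'a sgraph \<Rightarrow> 'a \<Rightarrow> 'a \<Rightarrow> 'a set \<Rightarrow> nat" where
  "num_shortest_paths_via G x y e = card {p \<in> shortest_paths G x y. e \<in> path_edges p}"

(* A pair with no path between its vertices contributes 0 / 0 = 0. *)
definition edge_betweenness :: "'a sgraph \<Rightarrow> 'a set \<Rightarrow> real" where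
  "edge_betweenness G e =
     (\<Sum>(x, y) \<in> {(x, y). x \<in> verts G \<and> y \<in> verts G \<and> x \<noteq> y}.
        real (num_shortest_paths_via G x y e) / real (num_shortest_paths G x y))"

definition edge_betweenness_uniform :: "'a sgraph \<Rightarrow> bool" where
  "edge_betweenness_uniform G \<longleftrightarrow>
     (\<forall>e\<in>edges G. \<forall>f\<in>edges G. edge_betweenness G e = edge_betweenness G f)"

(* The vertex v_i is represented by the residue i mod k, so v_k is 0. The condition u \<noteq> v
   only matters when some j in L is divisible by k, where simplicity rules out the loop. *)
definition circulant_graph :: "nat \<Rightarrow> nat list \<Rightarrow> int sgraph" where
  "circulant_graph k L =
     \<lparr>verts = {0..<int k},
      edges = {{u, v} |u v. u \<in> {0..<int k} \<and> v \<in> {0..<int k} \<and> u \<noteq> v \<and>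
                 (\<exists>j\<in>set L. [v = u + int j] (mod int k) \<or> [v = u - int j] (mod int k))}\<rparr>"

lemma simple_graph_circulant_graph: "simple_graph (circulant_graph k L)"
  by (auto simp: simple_graph_def circulant_graph_def)

end

theory Submission
  imports Defs "HOL-Library.Product_Plus"
begin

text \<open>
  Walks in \<open>C\<^bsub>k\<^esub>(1, s)\<close> from a fixed vertex are words of unit steps in \<open>\<int> \<times> \<int>\<close>, the step
  \<open>(a, b)\<close> moving by \<open>a + s b\<close>, and shortest paths are the words that are shortest among those with
  the same end modulo \<open>k\<close>. Fixing an edge and a position in a word at which a step of the right
  kind occurs determines the starting vertex. So the betweenness of an edge is the sum over all
  geodesic words of the number of steps of its kind, divided by the number of geodesic words with
  the same end. It therefore suffices to find an involution of the geodesic words which exchanges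
  the two kinds of steps and preserves the relation of having the same end.

  For \<open>k = 18 n + 3\<close> and \<open>s = 6 n\<close> the map \<open>(a, b) \<mapsto> (- b, - a)\<close> on steps does this, although it
  does not induce an automorphism of the graph. Every vertex is reached by a word of length at most
  \<open>3 n\<close>, and words that short have \<open>\<bar>a - b\<bar> \<le> 3 n\<close> for their coordinate sums. As \<open>6 n + 1\<close> divides
  \<open>k\<close>, two such words with the same end have the same \<open>a - b\<close>, and for a difference vector on the
  diagonal the map is just negation.
\<close>

section \<open>Words of unit steps and their walks\<close>

definition unit_steps :: "(int \<times> int) set" where
  "unit_steps = {(1, 0), (-1, 0), (0, 1), (0, -1)}"

text \<open>The assumptions make 1, -1, s and -s pairwise distinct and nonzero modulo k. Hence a
  step can be read off from the two vertices that it joins.\<close>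

locale two_jump_circulant =
  fixes k s :: nat
  assumes s_gt_1: "1 < s" and two_s_less_k: "2 * s < k"
begin

abbreviation G :: "int sgraph" where
  "G \<equiv> circulant_graph k [1, s]"

definition disp :: "int \<times> int \<Rightarrow> int" where
  "disp c = fst c + int s * snd c"

definition total :: "(int \<times> int) list \<Rightarrow> int" where
  "total w = sum_list (map disp w)"

definition walk :: "int \<Rightarrow> (int \<times> int) list \<Rightarrow> int list" where
  "walk x w = map (\<lambda>i. (x + total (take i w)) mod int k) [0..<Suc (length w)]"

text \<open>Minimality is over all words, including those whose walks repeat a vertex, and involves
  no starting vertex, so that it is the same condition for all translates of a walk.\<close>

definition geodesic :: "(int \<times> int) list \<Rightarrow> bool" where
  "geodesic w \<longleftrightarrow> w \<in> lists unit_steps \<and>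
     (\<forall>w'\<in>lists unit_steps. [total w' = total w] (mod int k) \<longrightarrow> length w \<le> length w')"

definition geodesics_to :: "int \<Rightarrow> (int \<times> int) list set" where
  "geodesics_to z = {w. geodesic w \<and> [total w = z] (mod int k)}"

lemma k_pos [simp]: "0 < k"
  using two_s_less_k by simp

lemma verts_G: "verts (circulant_graph k L) = {0..<int k}"
  by (simp add: circulant_graph_def)

lemma total_simps [simp]:
  "total [] = 0" "total (c # w) = disp c + total w" "total (v @ w) = total v + total w"
  by (simp_all add: total_def)

lemma total_take_Suc: "i < length w \<Longrightarrow> total (take (Suc i) w) = total (take i w) + disp (w ! i)"
  by (simp add: take_Suc_conv_app_nth)

lemma length_walk [simp]: "length (walk x w) = Suc (length w)"
  by (simp add: walk_def)

lemma nth_walk: "i \<le> length w \<Longrightarrow> walk x w ! i = (x + total (take i w)) mod int k"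
  by (simp add: walk_def del: upt_Suc)

section \<open>Unit steps modulo k and the edges of the graph\<close>

lemma cong_small_imp_eq:
  fixes a b :: int
  assumes "[a = b] (mod int k)" "\<bar>a - b\<bar> < int k"
  shows "a = b"
  using assms dvd_imp_le_int[of "a - b" "int k"] by (auto simp: cong_iff_dvd_diff)

lemma disp_inj_mod:
  assumes "c \<in> unit_steps" "d \<in> unit_steps" "[disp c = disp d] (mod int k)"
  shows "c = d"
proof -
  have "\<bar>disp c - disp d\<bar> < int k"
    using assms(1,2) s_gt_1 two_s_less_k by (auto simp: unit_steps_def disp_def)
  then have "disp c = disp d"
    using assms(3) cong_small_imp_eq by blast
  then show ?thesis
    using assms(1,2) s_gt_1 by (auto simp: unit_steps_def disp_def)
qed

lemma uminus_unit_steps: "c \<in> unit_steps \<Longrightarrow> - c \<in> unit_steps"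
  by (auto simp: unit_steps_def)

lemma disp_uminus [simp]: "disp (- c) = - disp c"
  by (simp add: disp_def)

lemma disp_not_cong_0:
  assumes "c \<in> unit_steps"
  shows "\<not> [disp c = 0] (mod int k)"
proof
  assume "[disp c = 0] (mod int k)"
  moreover have "\<bar>disp c - 0\<bar> < int k"
    using assms s_gt_1 two_s_less_k by (auto simp: unit_steps_def disp_def)
  ultimately have "disp c = 0"
    using cong_small_imp_eq by blast
  then show False
    using assms s_gt_1 by (auto simp: unit_steps_def disp_def)
qed

lemma ex_jump_iff_ex_step:
  "(\<exists>j\<in>set [1, s]. [v = u + int j] (mod int k) \<or> [v = u - int j] (mod int k)) \<longleftrightarrow>
   (\<exists>c\<in>unit_steps. [v = u + disp c] (mod int k))"
  by (auto simp: unit_steps_def disp_def)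

lemma edge_stepI:
  assumes "u \<in> {0..<int k}" "c \<in> unit_steps"
  shows "{u, (u + disp c) mod int k} \<in> edges G"
proof -
  have "(u + disp c) mod int k \<noteq> u"
  proof
    assume "(u + disp c) mod int k = u"
    then have "[u + disp c = u + 0] (mod int k)"
      using assms(1) by (simp add: cong_def)
    then show False
      using disp_not_cong_0[OF assms(2)] cong_add_lcancel by blast
  qed
  moreover have "\<exists>j\<in>set [1, s]. [(u + disp c) mod int k = u + int j] (mod int k) \<or>
      [(u + disp c) mod int k = u - int j] (mod int k)"
    unfolding ex_jump_iff_ex_step using assms(2) by (auto simp: cong_def)
  ultimately show ?thesis
    using assms(1) unfolding circulant_graph_def by fastforce
qed

lemma edge_stepE:
  assumes "{u, v} \<in> edges G"
  obtains c where "c \<in> unit_steps" "[v = u + disp c] (mod int k)"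
proof -
  obtain a b where ab: "{u, v} = {a, b}"
      "\<exists>j\<in>set [1, s]. [b = a + int j] (mod int k) \<or> [b = a - int j] (mod int k)"
    using assms unfolding circulant_graph_def sgraph.simps mem_Collect_eq by blast
  obtain c where c: "c \<in> unit_steps" "[b = a + disp c] (mod int k)"
    using ab(2) unfolding ex_jump_iff_ex_step by blast
  show thesis
  proof (cases "u = a \<and> v = b")
    case True
    then show thesis using c that by blast
  next
    \<comment> \<open>An edge is an unordered pair, so the jump may be recorded from
      \<open>v\<close> to \<open>u\<close>; the opposite step then leads from \<open>u\<close> to
      \<open>v\<close>.\<close>
    case False
    then have "u = b" "v = a" using ab(1) by (auto simp: doubleton_eq_iff)
    moreover have "[a = b + disp (- c)] (mod int k)"
      using c(2) by (simp add: cong_iff_dvd_diff dvd_diff_commute algebra_simps)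
    ultimately show thesis using c(1) that uminus_unit_steps by blast
  qed
qed

text \<open>A jump by -j is a jump by j seen from the other end, so only two kinds of edges have to
  be compared.\<close>

lemma edgeE:
  assumes "e \<in> edges G"
  obtains u c where "u \<in> {0..<int k}" "c \<in> {(1, 0), (0, 1)}" "e = {u, (u + disp c) mod int k}"
proof -
  obtain a b j where ab: "e = {a, b}" "a \<in> {0..<int k}" "b \<in> {0..<int k}" and j: "j \<in> set [1, s]"
      "[b = a + int j] (mod int k) \<or> [b = a - int j] (mod int k)"
    using assms unfolding circulant_graph_def sgraph.simps mem_Collect_eq by blast
  obtain c where c: "c \<in> {(1, 0), (0, 1)}" "disp c = int j"
    using j(1) that[of "(1, 0)"] that[of "(0, 1)"] by (auto simp: disp_def)
  show thesis
  proof (cases "[b = a + int j] (mod int k)")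
    case True
    then have "b = (a + disp c) mod int k" using ab c by (simp add: cong_def)
    then show thesis using that ab c by blast
  next
    case False
    then have "[a = b + int j] (mod int k)"
      using j(2) by (simp add: cong_iff_dvd_diff dvd_diff_commute algebra_simps)
    then have "a = (b + disp c) mod int k" using ab c by (simp add: cong_def)
    then have "e = {b, (b + disp c) mod int k}" using ab(1) by blast
    then show thesis using that ab c by blast
  qed
qed

section \<open>Correspondence between paths and walks\<close>

lemma path_between_imp_walk:
  assumes "path_between G x y p"
  obtains w where "w \<in> lists unit_steps" "p = walk x w" "[x + total w = y] (mod int k)"
proof -
  define m where "m = length p - 1"
  have p: "p \<noteq> []" "hd p = x" "last p = y" "set p \<subseteq> {0..<int k}"
    using assms by (auto simp: path_between_def verts_G)
  have len: "length p = Suc m" using p(1) by (simp add: m_def)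
  have "\<exists>c. c \<in> unit_steps \<and> [p ! Suc i = p ! i + disp c] (mod int k)" if "i < m" for i
  proof -
    have "{p ! i, p ! Suc i} \<in> edges G"
      using that assms len by (simp add: path_between_def)
    then show ?thesis by (blast elim: edge_stepE)
  qed
  then obtain f where f: "f i \<in> unit_steps" "[p ! Suc i = p ! i + disp (f i)] (mod int k)"
    if "i < m" for i by metis
  define w where "w = map f [0..<m]"
  have lw: "length w = m" by (simp add: w_def)
  have modp: "p ! i mod int k = p ! i" if "i \<le> m" for i
  proof -
    have "p ! i \<in> set p" using that len by simp
    then have "p ! i \<in> {0..<int k}" using p(4) by blast
    then show ?thesis by simp
  qed
  have nth: "p ! i = (x + total (take i w)) mod int k" if "i \<le> m" for i
    using that
  proof (induction i)
    case 0
    then show ?case using p(1,2) modp[of 0] by (simp add: hd_conv_nth)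
  next
    case (Suc i)
    have "p ! Suc i = p ! Suc i mod int k" using modp Suc.prems by simp
    also have "\<dots> = (p ! i + disp (f i)) mod int k"
      using f(2)[of i] Suc.prems by (simp add: cong_def)
    also have "\<dots> = (x + total (take i w) + disp (f i)) mod int k"
      using Suc by (simp add: mod_add_left_eq)
    also have "\<dots> = (x + total (take (Suc i) w)) mod int k"
      using Suc.prems lw by (simp add: total_take_Suc add.assoc) (simp add: w_def)
    finally show ?case .
  qed
  show thesis
  proof
    show "w \<in> lists unit_steps" using f(1) by (auto simp: w_def)
    show "p = walk x w"
      by (rule nth_equalityI) (use len lw nth in \<open>simp_all add: nth_walk\<close>)
    show "[x + total w = y] (mod int k)"
    proof -
      have "y = p ! m" using p(1,3) len by (simp add: last_conv_nth)
      moreover have "p ! m = (x + total w) mod int k" using nth[of m] lw by simp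
      ultimately show ?thesis by (simp add: cong_def)
    qed
  qed
qed

lemma walk_nth_Suc:
  "i < length w \<Longrightarrow> walk x w ! Suc i = (walk x w ! i + disp (w ! i)) mod int k"
  by (simp add: nth_walk total_take_Suc mod_add_left_eq add.assoc)

lemma walk_nth_in: "i \<le> length w \<Longrightarrow> walk x w ! i \<in> {0..<int k}"
  by (simp add: nth_walk)

lemma path_between_walk:
  assumes "w \<in> lists unit_steps" "x \<in> {0..<int k}" "y \<in> {0..<int k}"
    "[x + total w = y] (mod int k)" "distinct (walk x w)"
  shows "path_between G x y (walk x w)"
proof -
  have ne: "walk x w \<noteq> []" by (metis length_walk list.size(3) nat.distinct(1))
  have "last (walk x w) = y"
    using ne assms(3,4) by (simp add: last_conv_nth nth_walk cong_def)
  moreover have "hd (walk x w) = x"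
    using ne assms(2) by (simp add: hd_conv_nth nth_walk)
  moreover have "set (walk x w) \<subseteq> {0..<int k}"
    by (auto simp: walk_def)
  moreover have "{walk x w ! i, walk x w ! Suc i} \<in> edges G" if "i < length w" for i
  proof -
    have "w ! i \<in> unit_steps" using that assms(1) by auto
    then show ?thesis
      using edge_stepI[OF walk_nth_in[of i w x]] that by (simp add: walk_nth_Suc)
  qed
  ultimately show ?thesis
    using ne assms(5) by (simp add: path_between_def verts_G)
qed

section \<open>Geodesic words and shortest paths\<close>

lemma geodesic_in_lists: "geodesic w \<Longrightarrow> w \<in> lists unit_steps"
  by (simp add: geodesic_def)

text \<open>Cutting out the closed part of a self-intersecting walk would shorten it.\<close>

lemma distinct_walk:
  assumes "geodesic w"
  shows "distinct (walk x w)"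
proof -
  have "walk x w ! i \<noteq> walk x w ! j" if ij: "i < j" "j \<le> length w" for i j
  proof
    assume "walk x w ! i = walk x w ! j"
    then have "[x + total (take i w) = x + total (take j w)] (mod int k)"
      using ij by (simp add: nth_walk cong_def)
    then have "[total (take i w) = total (take j w)] (mod int k)"
      by (simp add: cong_add_lcancel)
    then have "[total (take i w) + total (drop j w) = total (take j w) + total (drop j w)] (mod int k)"
      by (simp add: cong_add_rcancel)
    then have "[total (take i w @ drop j w) = total w] (mod int k)"
      by (metis total_simps(3) append_take_drop_id)
    moreover have "take i w @ drop j w \<in> lists unit_steps"
      using geodesic_in_lists[OF assms] by (auto dest: in_set_takeD in_set_dropD)
    ultimately have "length w \<le> length (take i w @ drop j w)"
      using assms unfolding geodesic_def by blast
    then show False using ij by simp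
  qed
  then show ?thesis
    unfolding distinct_conv_nth length_walk
    by (metis less_Suc_eq_le nat_neq_iff)
qed

text \<open>A shortest word with the same end will do. This replaces an arbitrary competitor by a
  geodesic one, whose walk is known to be free of repetitions.\<close>

lemma ex_geodesic_le:
  assumes "w \<in> lists unit_steps"
  obtains w' where "geodesic w'" "[total w' = total w] (mod int k)" "length w' \<le> length w"
proof -
  let ?P = "\<lambda>v. v \<in> lists unit_steps \<and> [total v = total w] (mod int k)"
  obtain v where v: "?P v" "\<And>v'. ?P v' \<Longrightarrow> length v \<le> length v'"
    using ex_has_least_nat[of ?P w length] assms by auto
  have "geodesic v"
    unfolding geodesic_def using v by (meson cong_trans)
  then show thesis using that v assms by auto
qed

lemma shortest_paths_G:
  assumes "x \<in> {0..<int k}" "y \<in> {0..<int k}"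
  shows "shortest_paths G x y = walk x ` geodesics_to (y - x)"
proof -
  have to_iff: "[total w = y - x] (mod int k) \<longleftrightarrow> [x + total w = y] (mod int k)" for w
    by (simp add: cong_iff_dvd_diff algebra_simps)
  show ?thesis
  proof (intro equalityI subsetI)
    fix p assume "p \<in> shortest_paths G x y"
    then have p: "path_between G x y p" "\<And>q. path_between G x y q \<Longrightarrow> length p \<le> length q"
      by (auto simp: shortest_paths_def)
    obtain w where w: "w \<in> lists unit_steps" "p = walk x w" "[x + total w = y] (mod int k)"
      using path_between_imp_walk[OF p(1)] by blast
    have "length w \<le> length w'" if w': "w' \<in> lists unit_steps" "[total w' = total w] (mod int k)" for w'
    proof -
      \<comment> \<open>The walk of \<open>w'\<close> may repeat vertices and then is not a path, so
        the minimality of \<open>p\<close> is applied to a geodesic word with the same end.\<close>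
      obtain v where v: "geodesic v" "[total v = total w'] (mod int k)" "length v \<le> length w'"
        using ex_geodesic_le[OF w'(1)] by blast
      have "[total v = total w] (mod int k)"
        using v(2) w'(2) cong_trans by blast
      then have "[x + total v = y] (mod int k)"
        using w(3) by (meson cong_add_lcancel cong_trans)
      then have "path_between G x y (walk x v)"
        using v(1) assms path_between_walk distinct_walk geodesic_in_lists by blast
      then have "length w \<le> length v" using p(2) w(2) by fastforce
      then show ?thesis using v(3) by simp
    qed
    then show "p \<in> walk x ` geodesics_to (y - x)"
      using w by (auto simp: geodesics_to_def geodesic_def to_iff)
  next
    fix p assume "p \<in> walk x ` geodesics_to (y - x)"
    then obtain w where w: "geodesic w" "[x + total w = y] (mod int k)" "p = walk x w"
      by (auto simp: geodesics_to_def to_iff)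
    have "length p \<le> length q" if q: "path_between G x y q" for q
    proof -
      obtain w' where w': "w' \<in> lists unit_steps" "q = walk x w'" "[x + total w' = y] (mod int k)"
        using path_between_imp_walk[OF q] by blast
      have "[total w' = total w] (mod int k)"
        using w'(3) w(2) by (meson cong_add_lcancel cong_trans cong_sym)
      then show ?thesis using w w' unfolding geodesic_def by simp
    qed
    then show "p \<in> shortest_paths G x y"
      using w assms path_between_walk distinct_walk geodesic_in_lists
      by (simp add: shortest_paths_def)
  qed
qed

text \<open>Consecutive vertices determine the displacement modulo k and hence the step. Counting
  shortest paths thus becomes counting words.\<close>

lemma inj_on_walk: "inj_on (walk x) (lists unit_steps)"
proof (rule inj_onI)
  fix v w assume vw: "v \<in> lists unit_steps" "w \<in> lists unit_steps" "walk x v = walk x w"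
  have len: "length v = length w" using arg_cong[OF vw(3), of length] by simp
  show "v = w"
  proof (rule nth_equalityI[OF len])
    fix i assume i: "i < length v"
    have "(walk x v ! i + disp (v ! i)) mod int k = (walk x v ! i + disp (w ! i)) mod int k"
      using walk_nth_Suc[of i v x] walk_nth_Suc[of i w x] i len vw(3) by simp
    then have "[disp (v ! i) = disp (w ! i)] (mod int k)"
      by (metis cong_def cong_add_lcancel)
    then show "v ! i = w ! i"
      using disp_inj_mod vw i len by (metis in_listsD nth_mem)
  qed
qed

text \<open>The walk of a geodesic word visits distinct residues modulo k, which bounds its
  length.\<close>

lemma finite_geodesics: "finite (Collect geodesic)"
proof -
  have "length w \<le> k" if "geodesic w" for w
  proof -
    have "set (walk 0 w) \<subseteq> {0..<int k}" by (auto simp: walk_def)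
    then have "card (set (walk 0 w)) \<le> card {0..<int k}" by (intro card_mono) auto
    then show ?thesis using distinct_card[OF distinct_walk[OF that]] by simp
  qed
  then have "Collect geodesic \<subseteq> {w. set w \<subseteq> unit_steps \<and> length w \<le> k}"
    using geodesic_in_lists by auto
  then show ?thesis
    by (rule finite_subset) (simp add: finite_lists_length_le unit_steps_def)
qed

lemma card_shortest_paths_with:
  assumes "x \<in> {0..<int k}" "y \<in> {0..<int k}"
  shows "card {p \<in> shortest_paths G x y. P p} = card {w \<in> geodesics_to (y - x). P (walk x w)}"
proof -
  have "{p \<in> shortest_paths G x y. P p} = walk x ` {w \<in> geodesics_to (y - x). P (walk x w)}"
    using shortest_paths_G[OF assms] by auto
  moreover have "inj_on (walk x) {w \<in> geodesics_to (y - x). P (walk x w)}"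
    by (rule inj_on_subset[OF inj_on_walk]) (auto simp: geodesics_to_def geodesic_def)
  ultimately show ?thesis by (simp add: card_image)
qed

section \<open>Betweenness as a sum over geodesic words\<close>

lemma path_edges_walk:
  "path_edges (walk x w) = {{walk x w ! i, walk x w ! Suc i} |i. i < length w}"
  by (simp add: path_edges_def)

text \<open>A start whose walk uses the edge is matched with the position at which the walk does so.
  The step there is \<open>c\<close> or \<open>- c\<close>, according to the direction of
  travel.\<close>

lemma card_starts_via_edge:
  assumes w: "geodesic w" and u: "u \<in> {0..<int k}" and c: "c \<in> unit_steps"
  shows "card {x \<in> {0..<int k}. {u, (u + disp c) mod int k} \<in> path_edges (walk x w)} =
         card {i. i < length w \<and> w ! i \<in> {c, - c}}"
proof -
  define e where "e = {u, (u + disp c) mod int k}"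
  \<comment> \<open>The start that puts step \<open>i\<close> on the edge: the step must leave from
    \<open>u\<close> if it is \<open>c\<close>, and from the other end if it is
    \<open>- c\<close>.\<close>
  define start where "start i =
    ((if w ! i = c then u else u + disp c) - total (take i w)) mod int k" for i
  let ?I = "{i. i < length w \<and> w ! i \<in> {c, - c}}"
  let ?X = "{x \<in> {0..<int k}. e \<in> path_edges (walk x w)}"
  have via: "{walk (start i) w ! i, walk (start i) w ! Suc i} = e" if i: "i \<in> ?I" for i
  proof -
    have 1: "walk (start i) w ! i = (if w ! i = c then u else u + disp c) mod int k"
      using i by (simp add: nth_walk start_def mod_add_left_eq)
    show ?thesis
    proof (cases "w ! i = c")
      case True
      then have "walk (start i) w ! i = u" using 1 u by simp
      then show ?thesis using i True by (simp add: walk_nth_Suc e_def)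
    next
      case False
      then have "w ! i = - c" using i by simp
      moreover have "walk (start i) w ! i = (u + disp c) mod int k" using 1 False by simp
      ultimately show ?thesis
        using i u by (simp add: walk_nth_Suc e_def insert_commute mod_diff_left_eq)
    qed
  qed
  \<comment> \<open>A geodesic walk has distinct vertices and so runs along an edge at most
    once.\<close>
  have inj: "inj_on start ?I"
  proof (rule inj_onI)
    fix i j assume i: "i \<in> ?I" and j: "j \<in> ?I" and eq: "start i = start j"
    let ?p = "walk (start i) w"
    have "{?p ! i, ?p ! Suc i} = {?p ! j, ?p ! Suc j}" using via[OF i] via[OF j] eq by simp
    moreover have "?p ! a = ?p ! b \<longleftrightarrow> a = b" if "a \<le> length w" "b \<le> length w" for a b
      using nth_eq_iff_index_eq[OF distinct_walk[OF w]] that by simp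
    ultimately show "i = j" using i j by (auto simp: doubleton_eq_iff)
  qed
  have "start ` ?I = ?X"
  proof (intro equalityI subsetI)
    fix x assume "x \<in> start ` ?I"
    then obtain i where i: "i \<in> ?I" "x = start i" by blast
    then have "e \<in> path_edges (walk x w)"
      using via[OF i(1)] unfolding path_edges_walk by blast
    then show "x \<in> ?X" using i(2) by (simp add: start_def)
  next
    fix x assume x: "x \<in> ?X"
    then obtain i where i: "i < length w" and e: "e = {walk x w ! i, walk x w ! Suc i}"
      by (auto simp: path_edges_walk)
    have wi: "w ! i \<in> unit_steps" using geodesic_in_lists[OF w] i by auto
    have Suc: "walk x w ! Suc i = (walk x w ! i + disp (w ! i)) mod int k"
      using i by (rule walk_nth_Suc)
    have x_eq: "x = (walk x w ! i - total (take i w)) mod int k"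
      using x i by (simp add: nth_walk mod_diff_left_eq)
    consider "walk x w ! i = u" "walk x w ! Suc i = (u + disp c) mod int k"
      | "walk x w ! i = (u + disp c) mod int k" "walk x w ! Suc i = u"
      using e unfolding e_def by (auto simp: doubleton_eq_iff)
    then show "x \<in> start ` ?I"
    proof cases
      case 1
      then have "[u + disp (w ! i) = u + disp c] (mod int k)" using Suc by (simp add: cong_def)
      then have "w ! i = c" using disp_inj_mod wi c cong_add_lcancel by blast
      then have "start i = x" using x_eq 1 by (simp add: start_def)
      then show ?thesis using i \<open>w ! i = c\<close> by blast
    next
      case 2
      then have "(u + (disp c + disp (w ! i))) mod int k = u mod int k"
        using Suc u by (simp add: mod_add_left_eq add.assoc)
      then have "[u + (disp c + disp (w ! i)) = u + 0] (mod int k)" by (simp add: cong_def)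
      then have "[disp c + disp (w ! i) = 0] (mod int k)" using cong_add_lcancel by blast
      then have "[disp (w ! i) = disp (- c)] (mod int k)"
        by (simp add: cong_iff_dvd_diff add.commute)
      then have wc: "w ! i = - c" using disp_inj_mod wi uminus_unit_steps[OF c] by blast
      have "- c \<noteq> c" using c by (auto simp: unit_steps_def)
      then have "start i = x" using x_eq 2 wc by (simp add: start_def mod_diff_left_eq)
      then show ?thesis using i wc by blast
    qed
  qed
  then have "card ?X = card ?I" using card_image[OF inj] by simp
  then show ?thesis by (simp add: e_def)
qed

text \<open>Shortest paths are replaced by their words, the sum over starts is moved inside, and the
  starts are counted for each word. The result is independent of \<open>u\<close>, so edges of the
  same kind have the same betweenness.\<close>

lemma edge_betweenness_step:
  assumes u: "u \<in> {0..<int k}" and c: "c \<in> unit_steps"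
  shows "edge_betweenness G {u, (u + disp c) mod int k} =
    (\<Sum>w | geodesic w. real (card {i. i < length w \<and> w ! i \<in> {c, - c}}) /
       real (card (geodesics_to (total w))))"
proof -
  let ?V = "{0..<int k}" and ?e = "{u, (u + disp c) mod int k}"
  define h where "h x w =
    of_bool (?e \<in> path_edges (walk x w)) / real (card (geodesics_to (total w)))" for x w
  define r where "r x y =
    real (num_shortest_paths_via G x y ?e) / real (num_shortest_paths G x y)" for x y
  have to: "geodesics_to (y - x) = {w \<in> Collect geodesic. (x + total w) mod int k = y}"
    if "y \<in> ?V" for x y
  proof -
    have "[total w = y - x] (mod int k) \<longleftrightarrow> (x + total w) mod int k = y mod int k" for w
      unfolding cong_def[symmetric] by (simp add: cong_iff_dvd_diff algebra_simps)
    then show ?thesis using that by (auto simp: geodesics_to_def)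
  qed
  have r: "r x y = (\<Sum>w\<in>geodesics_to (y - x). h x w)" if "x \<in> ?V" "y \<in> ?V" for x y
  proof -
    have fin: "finite (geodesics_to (y - x))"
      using finite_geodesics by (rule finite_subset[rotated]) (auto simp: geodesics_to_def)
    have "geodesics_to (total w) = geodesics_to (y - x)" if "w \<in> geodesics_to (y - x)" for w
      using that by (auto simp: geodesics_to_def cong_def)
    then have "(\<Sum>w\<in>geodesics_to (y - x). h x w) =
        (\<Sum>w\<in>geodesics_to (y - x). of_bool (?e \<in> path_edges (walk x w)))
          / real (card (geodesics_to (y - x)))"
      unfolding sum_divide_distrib by (intro sum.cong) (simp_all add: h_def)
    also have "(\<Sum>w\<in>geodesics_to (y - x). of_bool (?e \<in> path_edges (walk x w))) =
        real (card {w \<in> geodesics_to (y - x). ?e \<in> path_edges (walk x w)})"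
      using fin by (simp add: Int_def)
    finally show ?thesis
      using card_shortest_paths_with[OF that, of "\<lambda>_. True"]
        card_shortest_paths_with[OF that, of "\<lambda>p. ?e \<in> path_edges p"]
      by (simp add: r_def num_shortest_paths_via_def num_shortest_paths_def)
  qed
  \<comment> \<open>The only geodesic word that returns to its start is empty and uses no edge. So
    the pairs with equal ends can be added to the sum, and \<open>y\<close> ranges over all
    vertices.\<close>
  have diag: "r x x = 0" if "x \<in> ?V" for x
  proof -
    have "h x w = 0" if "w \<in> geodesics_to (x - x)" for w
    proof -
      have "[total [] = total w] (mod int k)"
        using that by (simp add: geodesics_to_def cong_sym_eq)
      then have "length w \<le> length ([] :: (int \<times> int) list)"
        using that unfolding geodesics_to_def geodesic_def by blast
      then show ?thesis by (simp add: h_def path_edges_walk)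
    qed
    then show ?thesis using r[OF that that] by simp
  qed
  have "{(x, y). x \<in> verts G \<and> y \<in> verts G \<and> x \<noteq> y} = (SIGMA x:?V. ?V - {x})"
    by (auto simp: verts_G)
  then have "edge_betweenness G ?e = (\<Sum>x\<in>?V. \<Sum>y\<in>?V - {x}. r x y)"
    by (simp add: edge_betweenness_def r_def sum.Sigma)
  also have "\<dots> = (\<Sum>x\<in>?V. \<Sum>y\<in>?V. r x y)"
    by (rule sum.cong[OF refl]) (simp add: sum_diff1 diag)
  also have "\<dots> = (\<Sum>x\<in>?V. \<Sum>y\<in>?V. \<Sum>w | w \<in> Collect geodesic \<and> (x + total w) mod int k = y. h x w)"
    by (intro sum.cong refl) (use r to in simp)
  \<comment> \<open>From a fixed \<open>x\<close>, each word leads to exactly one vertex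
    \<open>y\<close>.\<close>
  also have "\<dots> = (\<Sum>x\<in>?V. \<Sum>w | geodesic w. h x w)"
    by (intro sum.cong refl sum.group) (auto simp: finite_geodesics)
  also have "\<dots> = (\<Sum>w | geodesic w. \<Sum>x\<in>?V. h x w)"
    by (rule sum.swap)
  also have "\<dots> = (\<Sum>w | geodesic w. real (card {i. i < length w \<and> w ! i \<in> {c, - c}}) /
       real (card (geodesics_to (total w))))"
  proof (intro sum.cong refl)
    fix w assume "w \<in> Collect geodesic"
    then have w: "geodesic w" by simp
    have "(\<Sum>x\<in>?V. h x w) = real (card {x \<in> ?V. ?e \<in> path_edges (walk x w)})
        / real (card (geodesics_to (total w)))"
      by (simp add: h_def Int_def flip: sum_divide_distrib)
    then show "(\<Sum>x\<in>?V. h x w) = real (card {i. i < length w \<and> w ! i \<in> {c, - c}}) /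
       real (card (geodesics_to (total w)))"
      using card_starts_via_edge[OF w u c] by simp
  qed
  finally show ?thesis .
qed

end

section \<open>The exchange of the two kinds of steps\<close>

definition swap_steps :: "(int \<times> int) list \<Rightarrow> (int \<times> int) list" where
  "swap_steps = map (\<lambda>(a, b). (- b, - a))"

lemma length_swap_steps [simp]: "length (swap_steps w) = length w"
  by (simp add: swap_steps_def)

lemma swap_steps_swap_steps [simp]: "swap_steps (swap_steps w) = w"
  by (induction w) (auto simp: swap_steps_def)

lemma swap_steps_in_lists:
  assumes "w \<in> lists unit_steps"
  shows "swap_steps w \<in> lists unit_steps"
proof -
  have "(- b, - a) \<in> unit_steps" if "(a, b) \<in> unit_steps" for a b
    using that by (auto simp: unit_steps_def)
  then show ?thesis
    using assms unfolding swap_steps_def by (induction w) auto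
qed

lemma nth_swap_steps: "i < length w \<Longrightarrow> swap_steps w ! i = (- snd (w ! i), - fst (w ! i))"
  by (simp add: swap_steps_def case_prod_beta)

text \<open>On coordinate sums the exchange is the reflection that fixes a - b and negates a +
  b.\<close>

lemma sum_list_swap_steps:
  "sum_list (map fst (swap_steps w)) = - sum_list (map snd w)"
  "sum_list (map snd (swap_steps w)) = - sum_list (map fst w)"
  by (induction w) (simp_all add: swap_steps_def case_prod_beta)

text \<open>Each unit step changes the difference of the coordinates by 1 or -1.\<close>

lemma abs_fst_minus_snd_le_length:
  "w \<in> lists unit_steps \<Longrightarrow>
    \<bar>sum_list (map fst w) - sum_list (map snd w)\<bar> \<le> int (length w)"
proof (induction w)
  case (Cons c w)
  have "c \<in> unit_steps" using Cons.prems by simp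
  then have "\<bar>fst c - snd c\<bar> \<le> 1" by (auto simp: unit_steps_def)
  moreover have "\<bar>sum_list (map fst w) - sum_list (map snd w)\<bar> \<le> int (length w)"
    using Cons by simp
  ultimately show ?case
    unfolding list.map sum_list.Cons list.size of_nat_add of_nat_Suc of_nat_1 by linarith
qed simp

lemma (in two_jump_circulant) total_conv:
  "total w = sum_list (map fst w) + int s * sum_list (map snd w)"
  by (induction w) (simp_all add: disp_def distrib_left)

section \<open>The case k = 18 n + 3, s = 6 n\<close>

locale narrow_circulant =
  fixes n :: nat
  assumes n_ge_1: "1 \<le> n"
begin

sublocale two_jump_circulant "18 * n + 3" "6 * n"
  by unfold_locales (use n_ge_1 in simp_all)

text \<open>In the coordinates \<open>(a + b, a - b)\<close> the word length is the maximum norm, and the words ending at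
  0 form the lattice spanned by \<open>(6, 0)\<close> and \<open>(-1, 6 n + 1)\<close>. The point \<open>(z, z)\<close> is reduced with
  the multiples \<open>q\<close> and \<open>t\<close> of these two vectors.\<close>

lemma ex_short_word:
  obtains w where "w \<in> lists unit_steps" "length w \<le> 3 * n"
    "[total w = z] (mod int (18 * n + 3))"
proof -
  define N where "N = int n"
  \<comment> \<open>Both quotients are rounded to a nearest integer by adding half the divisor
    first. This leaves a - b between -3 N and 3 N, and a + b between -3 and 2.\<close>
  define t where "t = (z + 3 * N) div (6 * N + 1)"
  define q where "q = (z + t + 3) div 6"
  define a where "a = z - 3 * q - 3 * N * t"
  define b where "b = t * (3 * N + 1) - 3 * q"
  \<comment> \<open>If \<open>a\<close> is 0 then \<open>(sgn a, 0)\<close> is not a unit step, but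
    it is repeated 0 times; likewise for \<open>b\<close>.\<close>
  define w where "w = replicate (nat \<bar>a\<bar>) (sgn a, 0) @ replicate (nat \<bar>b\<bar>) (0, sgn b)"
  have N: "N \<ge> 1" using n_ge_1 by (simp add: N_def)
  have "z + 3 * N = t * (6 * N + 1) + (z + 3 * N) mod (6 * N + 1)"
    unfolding t_def by (rule div_mult_mod_eq[symmetric])
  moreover have "0 \<le> (z + 3 * N) mod (6 * N + 1)" "(z + 3 * N) mod (6 * N + 1) < 6 * N + 1"
    by (rule pos_mod_sign pos_mod_bound, use N in linarith)+
  ultimately have v: "\<bar>a - b\<bar> \<le> 3 * N"
    by (simp add: a_def b_def algebra_simps)
  have "z + t + 3 = q * 6 + (z + t + 3) mod 6"
    by (simp add: q_def)
  moreover have "0 \<le> (z + t + 3) mod 6" "(z + t + 3) mod 6 < 6"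
    by simp_all
  moreover have "a + b = z + t - 6 * q"
    by (simp add: a_def b_def algebra_simps)
  ultimately have "\<bar>a + b\<bar> \<le> 3"
    by linarith
  then have "\<bar>a\<bar> + \<bar>b\<bar> \<le> 3 * N"
    using v N by linarith
  then have len: "length w \<le> 3 * n"
    by (simp add: w_def N_def)
  have "total w = a + 6 * N * b"
    unfolding total_conv by (simp add: w_def N_def sum_list_replicate abs_mult_sgn)
  \<comment> \<open>The two lattice vectors have totals k and - N k; subtracting them
    \<open>q\<close> and \<open>t\<close> times gives this multiple of k.\<close>
  also have "\<dots> = z + (N * t - q) * (18 * N + 3)"
    by (simp add: a_def b_def algebra_simps)
  finally have "[total w = z] (mod int (18 * n + 3))"
    by (simp add: cong_iff_dvd_diff N_def)
  moreover have "w \<in> lists unit_steps"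
    by (auto simp: w_def unit_steps_def sgn_if)
  ultimately show thesis using that len by blast
qed

lemma length_geodesic_le:
  assumes "geodesic w"
  shows "length w \<le> 3 * n"
proof -
  obtain v where v: "v \<in> lists unit_steps" "length v \<le> 3 * n"
      "[total v = total w] (mod int (18 * n + 3))"
    using ex_short_word by blast
  then have "length w \<le> length v" using assms unfolding geodesic_def by blast
  then show ?thesis using v(2) by (rule order_trans)
qed

text \<open>The bound 3 n on both lengths keeps the two values of a - b at most 6 n apart, just
  below the divisor 6 n + 1 of their difference.\<close>

lemma cong_total_swap_steps:
  assumes "v \<in> lists unit_steps" "length v \<le> 3 * n" "w \<in> lists unit_steps" "length w \<le> 3 * n"
    and cong: "[total v = total w] (mod int (18 * n + 3))"
  shows "[total (swap_steps v) = total (swap_steps w)] (mod int (18 * n + 3))"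
proof -
  define a where "a = sum_list (map fst v) - sum_list (map fst w)"
  define b where "b = sum_list (map snd v) - sum_list (map snd w)"
  have dvd: "int (18 * n + 3) dvd a + 6 * int n * b"
    using cong unfolding cong_iff_dvd_diff total_conv a_def b_def
    by (simp only: of_nat_mult of_nat_numeral algebra_simps)
  have "int (18 * n + 3) = (6 * int n + 1) * 3" by simp
  then have "6 * int n + 1 dvd a + 6 * int n * b"
    using dvd by (metis dvd_mult_left)
  \<comment> \<open>Modulo 6 n + 1 the long jump 6 n is -1, so the total reduces to a - b.\<close>
  moreover have "a + 6 * int n * b = (a - b) + (6 * int n + 1) * b"
    by (simp add: algebra_simps)
  ultimately have "6 * int n + 1 dvd a - b"
    by (metis dvd_add_left_iff dvd_triv_left)
  moreover have "\<bar>a - b\<bar> < 6 * int n + 1"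
    using abs_fst_minus_snd_le_length[OF assms(1)] abs_fst_minus_snd_le_length[OF assms(3)]
      assms(2,4) by (simp add: a_def b_def)
  ultimately have "a = b"
    using dvd_imp_le_int[of "a - b" "6 * int n + 1"] by fastforce
  \<comment> \<open>The swapped words differ by (-b, -a), which is the negative of (a, b) because a
    = b.\<close>
  then have "int (18 * n + 3) dvd - (b + 6 * int n * a)"
    using dvd \<open>a = b\<close> by (simp only: dvd_minus_iff)
  also have "- (b + 6 * int n * a) = total (swap_steps v) - total (swap_steps w)"
    unfolding total_conv sum_list_swap_steps a_def b_def by (simp add: algebra_simps)
  finally show ?thesis by (simp add: cong_iff_dvd_diff)
qed

lemma geodesic_swap_steps:
  assumes w: "geodesic w"
  shows "geodesic (swap_steps w)"
  unfolding geodesic_def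
proof (intro conjI ballI impI)
  show "swap_steps w \<in> lists unit_steps"
    using w by (simp add: geodesic_in_lists swap_steps_in_lists)
  fix w' assume w': "w' \<in> lists unit_steps" "[total w' = total (swap_steps w)] (mod int (18 * n + 3))"
  \<comment> \<open>The competitor \<open>w'\<close> may be too long for the congruence to survive
    the exchange; a geodesic word with the same end has length at most 3 n. Swapped back, it
    competes with \<open>w\<close>.\<close>
  obtain v where v: "geodesic v" "[total v = total w'] (mod int (18 * n + 3))" "length v \<le> length w'"
    using ex_geodesic_le[OF w'(1)] by blast
  have "[total v = total (swap_steps w)] (mod int (18 * n + 3))"
    using v(2) w'(2) cong_trans by blast
  then have "[total (swap_steps v) = total (swap_steps (swap_steps w))] (mod int (18 * n + 3))"
    using v(1) w by (intro cong_total_swap_steps)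
      (simp_all add: geodesic_in_lists length_geodesic_le swap_steps_in_lists)
  then have "length w \<le> length (swap_steps v)"
    using w swap_steps_in_lists[OF geodesic_in_lists[OF v(1)]]
    unfolding geodesic_def swap_steps_swap_steps by blast
  then show "length (swap_steps w) \<le> length w'"
    using v(3) by simp
qed

lemma swap_steps_in_geodesics_to:
  assumes "geodesic w" "v \<in> geodesics_to (total w)"
  shows "swap_steps v \<in> geodesics_to (total (swap_steps w))"
proof -
  have v: "geodesic v" "[total v = total w] (mod int (18 * n + 3))"
    using assms(2) by (simp_all only: geodesics_to_def mem_Collect_eq)
  have "[total (swap_steps v) = total (swap_steps w)] (mod int (18 * n + 3))"
    using assms(1) v by (intro cong_total_swap_steps geodesic_in_lists length_geodesic_le)
  then show ?thesis
    using geodesic_swap_steps[OF v(1)] by (simp only: geodesics_to_def mem_Collect_eq simp_thms)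
qed

text \<open>The exchange is its own inverse and maps each of the two classes into the other.\<close>

lemma card_geodesics_to_swap_steps:
  assumes "geodesic w"
  shows "card (geodesics_to (total (swap_steps w))) = card (geodesics_to (total w))"
proof -
  have "bij_betw swap_steps (geodesics_to (total w)) (geodesics_to (total (swap_steps w)))"
    by (rule bij_betw_byWitness[where f' = swap_steps])
      (use assms swap_steps_in_geodesics_to[of w]
         swap_steps_in_geodesics_to[OF geodesic_swap_steps[of w]] in auto)
  then show ?thesis by (simp add: bij_betw_same_card)
qed

text \<open>Reindexing the sum over geodesic words by the exchange turns occurrences of one kind of
  step into occurrences of the other and keeps the denominators.\<close>

lemma edge_betweenness_jumps:
  assumes "u \<in> {0..<int (18 * n + 3)}" "v \<in> {0..<int (18 * n + 3)}"
  shows "edge_betweenness G {u, (u + disp (1, 0)) mod int (18 * n + 3)} =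
    edge_betweenness G {v, (v + disp (0, 1)) mod int (18 * n + 3)}"
proof -
  define h where "h c w = real (card {i. i < length w \<and> w ! i \<in> {c, - c}}) /
    real (card (geodesics_to (total w)))" for c :: "int \<times> int" and w
  have "h (1, 0) w = h (0, 1) (swap_steps w)" if "geodesic w" for w
  proof -
    have "{i. i < length (swap_steps w) \<and> swap_steps w ! i \<in> {(0, 1), - (0, 1)}} =
        {i. i < length w \<and> w ! i \<in> {(1, 0), - (1, 0)}}"
      by (auto simp: nth_swap_steps prod_eq_iff)
    then show ?thesis using that by (simp add: h_def card_geodesics_to_swap_steps)
  qed
  then have "(\<Sum>w | geodesic w. h (1, 0) w) = (\<Sum>w | geodesic w. h (0, 1) w)"
    by (intro sum.reindex_bij_witness[of _ swap_steps swap_steps])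
      (simp_all add: geodesic_swap_steps)
  then show ?thesis
    using edge_betweenness_step[OF assms(1), of "(1, 0)"]
      edge_betweenness_step[OF assms(2), of "(0, 1)"]
    by (simp add: h_def unit_steps_def)
qed

lemma edge_betweenness_uniform_G: "edge_betweenness_uniform G"
proof -
  have "edge_betweenness G e =
      edge_betweenness G {0, (0 + disp (0, 1)) mod int (18 * n + 3)}" if e: "e \<in> edges G" for e
  proof -
    obtain u c where uc: "u \<in> {0..<int (18 * n + 3)}" "c \<in> {(1, 0), (0, 1)}"
        "e = {u, (u + disp c) mod int (18 * n + 3)}"
      using edgeE[OF e] by blast
    have 0: "0 \<in> {0..<int (18 * n + 3)}" by simp
    \<comment> \<open>Two edges of the long kind are compared through the short edge at 0.\<close>
    show ?thesis
      using uc edge_betweenness_jumps[OF uc(1) 0] edge_betweenness_jumps[OF 0 uc(1)]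
        edge_betweenness_jumps[OF 0 0] by fastforce
  qed
  then show ?thesis by (simp add: edge_betweenness_uniform_def)
qed

end

theorem theorem2p5:
  fixes n :: nat
  assumes "n \<ge> 1"
  shows "edge_betweenness_uniform (circulant_graph (18 * n + 3) [1, 6 * n])"
proof -
  interpret narrow_circulant n
    by unfold_locales (fact assms)
  show ?thesis by (rule edge_betweenness_uniform_G)
qed

end
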